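(* Let $G=(V,E)$ be a graph on $n$ vertices with maximum clique size $k$ and degeneracy $d$. Let $P=\{x\in[0,1]^n: x_u+x_v\le 1\ \ \forall\, u\ne v\in V \text{ with } uv\notin E\}$ be the fractional clique polytope of $G$. Let $\mathcal{T}^{\pi,k}$ be a skewed $k$-tree (for any permutation $\pi$ of the $n$ variables). Then $\mathcal{T}^{\pi,k}(P)=P_I$, while $SA^{\lfloor n/(d+1)-3\rfloor}(P)\ne P_I$ (the latter whenever $\lfloor n/(d+1)-3\rfloor\ge 0$, so that this level is defined).
   Context: Graphs are finite and simple; $V$ is identified with $[n]=\{1,\dots,n\}$. A graph $G$ is $d$-degenerate if each of its subgraphs has minimum degree at most $d$; the degeneracy of $G$ is the smallest $d$ such that $G$ is $d$-degenerate. For a polytope $P\subseteq[0,1]^n$, $P_I:=\mathrm{conv}(P\cap\{0,1\}^n)$. A branch-and-bound (BB) tree $\mathcal{T}$ is a rooted binary tree in which each node has $0$ or $2$ children. Each node $v$ carries a set $C_v$ of branching constraints. The root has $C_{\mathrm{root}}=\emptyset$. If a node $v$ has two children, they are obtained by branching on a variable $x_j$, $j\in[n]$, not already branched on at an ancestor of $v$: one child has branching constraints $C_v\cup\{x_j=0\}$ and the other $C_v\cup\{x_j=1\}$. Write $J_v^1:=\{j:\{x_j=1\}\in C_v\}$. For a polytope $P$, the atom of $v$ is $P_v:=P\cap\{x:C_v\}$ (points of $P$ satisfying all constraints in $C_v$), and $\mathcal{T}(P):=\mathrm{conv}\big(\bigcup_{v\in\mathrm{leaves}(\mathcal{T})}P_v\big)$.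 Skewed $k$-tree $\mathcal{T}^{\pi,k}$: Let $\mathcal{T}_0$ consist of only the root. For $i=1,\dots,n$ in order, $\mathcal{T}_i$ is obtained from $\mathcal{T}_{i-1}$ by branching on variable $x_{\pi(i)}$ at every leaf $v$ of $\mathcal{T}_{i-1}$ with $|J_v^1|<k$ (other leaves are left unchanged). Set $\mathcal{T}^{\pi,k}:=\mathcal{T}_n$. Sherali-Adams: let $P$ be described by a finite system of linear inequalities that includes $0\le x_i\le 1$ for $i\in[n]$. For each inequality $ax-b\ge0$ of the system and each pair of disjoint sets $I,J\subseteq[n]$ with $|I|+|J|\le k$, form $(ax-b)\prod_{i\in I}x_i\prod_{j\in J}(1-x_j)\ge 0$, expand, replace each $x_i^2$ by $x_i$, and replace each monomial $\prod_{i\in S}x_i$ by a variable $y_S$, with $y_\emptyset=1$ and $y_{\{i\}}=x_i$. $SA^k(P)$ is the projection onto the $x$-space of the polyhedron defined by the resulting linear inequalities; $SA^0(P)=P$. *)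

theory Defs
  imports "HOL-Analysis.Analysis"
begin

section \<open>Graphs\<close>

definition simple_graph :: "'a set \<Rightarrow> 'a set set \<Rightarrow> bool" where
  "simple_graph V E \<longleftrightarrow> finite V \<and> (\<forall>e\<in>E. e \<subseteq> V \<and> card e = 2)"

definition subgraph :: "'a set \<Rightarrow> 'a set set \<Rightarrow> 'a set \<Rightarrow> 'a set set \<Rightarrow> bool" where
  "subgraph W F V E \<longleftrightarrow> W \<subseteq> V \<and> F \<subseteq> E \<and> simple_graph W F"

definition degree :: "'a set set \<Rightarrow> 'a \<Rightarrow> nat" where
  "degree E v = card {e \<in> E. v \<in> e}"

definition min_degree :: "'a set \<Rightarrow> 'a set set \<Rightarrow> nat" where
  "min_degree V E = Min (degree E ` V)"

text \<open>The subgraph without vertices has no minimum degree and is excluded.\<close>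

definition degenerate :: "nat \<Rightarrow> 'a set \<Rightarrow> 'a set set \<Rightarrow> bool" where
  "degenerate d V E \<longleftrightarrow>
     (\<forall>W F. subgraph W F V E \<longrightarrow> W \<noteq> {} \<longrightarrow> min_degree W F \<le> d)"

definition degeneracy :: "'a set \<Rightarrow> 'a set set \<Rightarrow> nat" where
  "degeneracy V E = (LEAST d. degenerate d V E)"

definition clique :: "'a set \<Rightarrow> 'a set set \<Rightarrow> 'a set \<Rightarrow> bool" where
  "clique V E C \<longleftrightarrow> C \<subseteq> V \<and> (\<forall>u\<in>C. \<forall>v\<in>C. u \<noteq> v \<longrightarrow> {u, v} \<in> E)"

definition clique_number :: "'a set \<Rightarrow> 'a set set \<Rightarrow> nat" where
  "clique_number V E = Max {card C |C. clique V E C}"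


section \<open>Polytopes in the unit cube\<close>

text \<open>The coordinates of \<open>real ^ 'n\<close> are indexed by the vertices, which are the
  elements of the finite type \<open>'n\<close>.\<close>

definition fractional_clique_polytope :: "'n::finite set set \<Rightarrow> (real ^ 'n) set" where
  "fractional_clique_polytope E =
     {x. (\<forall>i. 0 \<le> x $ i \<and> x $ i \<le> 1) \<and>
         (\<forall>u v. u \<noteq> v \<longrightarrow> {u, v} \<notin> E \<longrightarrow> x $ u + x $ v \<le> 1)}"

definition integer_hull :: "(real ^ 'n::finite) set \<Rightarrow> (real ^ 'n) set" where
  "integer_hull P = convex hull (P \<inter> {x. \<forall>i. x $ i \<in> {0, 1}})"


section \<open>Branch-and-bound trees\<close>

text \<open>In \<open>Branch j l r\<close>, the child \<open>l\<close> gets the constraint \<open>x\<^sub>j = 0\<close> and the child \<open>r\<close> the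
  constraint \<open>x\<^sub>j = 1\<close>. A pair \<open>(j, b)\<close> encodes the branching constraint \<open>x\<^sub>j = of_bool b\<close>.
  The set \<open>C\<^sub>v\<close> of a node is not stored, but collected along the path from the root; it is the
  argument \<open>C\<close> of the functions below, which is \<open>{}\<close> at the root.\<close>

datatype 'n bb_tree = Leaf | Branch 'n "'n bb_tree" "'n bb_tree"

type_synonym 'n constraints = "('n \<times> bool) set"

definition ones :: "'n constraints \<Rightarrow> 'n set" where
  "ones C = {j. (j, True) \<in> C}"

fun leaves :: "'n constraints \<Rightarrow> 'n bb_tree \<Rightarrow> 'n constraints set" where
  "leaves C Leaf = {C}"
| "leaves C (Branch j l r) =
     leaves (insert (j, False) C) l \<union> leaves (insert (j, True) C) r"

definition atom :: "(real ^ 'n::finite) set \<Rightarrow> 'n constraints \<Rightarrow> (real ^ 'n) set" where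
  "atom P C = P \<inter> {x. \<forall>(j, b)\<in>C. x $ j = of_bool b}"

definition bb_hull :: "'n bb_tree \<Rightarrow> (real ^ 'n::finite) set \<Rightarrow> (real ^ 'n) set" where
  "bb_hull T P = convex hull (\<Union>C\<in>leaves {} T. atom P C)"

fun branch_leaves :: "nat \<Rightarrow> 'n \<Rightarrow> 'n constraints \<Rightarrow> 'n bb_tree \<Rightarrow> 'n bb_tree" where
  "branch_leaves k j C Leaf = (if card (ones C) < k then Branch j Leaf Leaf else Leaf)"
| "branch_leaves k j C (Branch i l r) =
     Branch i (branch_leaves k j (insert (i, False) C) l)
              (branch_leaves k j (insert (i, True) C) r)"

primrec skewed_stage :: "(nat \<Rightarrow> 'n) \<Rightarrow> nat \<Rightarrow> nat \<Rightarrow> 'n bb_tree" where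
  "skewed_stage \<pi> k 0 = Leaf"
| "skewed_stage \<pi> k (Suc i) = branch_leaves k (\<pi> (Suc i)) {} (skewed_stage \<pi> k i)"

definition skewed_tree :: "(nat \<Rightarrow> 'n::finite) \<Rightarrow> nat \<Rightarrow> 'n bb_tree" where
  "skewed_tree \<pi> k = skewed_stage \<pi> k CARD('n)"

text \<open>The datatype does not forbid branching on a variable twice along a path. Skewed trees
  never do.\<close>

fun no_rebranching :: "'n set \<Rightarrow> 'n bb_tree \<Rightarrow> bool" where
  "no_rebranching A Leaf \<longleftrightarrow> True"
| "no_rebranching A (Branch j l r) \<longleftrightarrow>
     j \<notin> A \<and> no_rebranching (insert j A) l \<and> no_rebranching (insert j A) r"

lemma set_branch_leaves: "set_bb_tree (branch_leaves k j C t) \<subseteq> insert j (set_bb_tree t)"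
proof (induction t arbitrary: C)
  case (Branch i l r)
  show ?case
    using Branch.IH(1)[of "insert (i, False) C"] Branch.IH(2)[of "insert (i, True) C"] by auto
qed simp

lemma no_rebranching_branch_leaves:
  "no_rebranching A t \<Longrightarrow> j \<notin> A \<Longrightarrow> j \<notin> set_bb_tree t \<Longrightarrow>
     no_rebranching A (branch_leaves k j C t)"
  by (induction t arbitrary: A C) auto

lemma set_skewed_stage: "set_bb_tree (skewed_stage \<pi> k i) \<subseteq> \<pi> ` {1..i}"
proof (induction i)
  case (Suc i)
  have "{1..Suc i} = insert (Suc i) {1..i}"
    by auto
  then show ?case
    using Suc set_branch_leaves[of k "\<pi> (Suc i)" "{}" "skewed_stage \<pi> k i"] by auto
qed simp

lemma no_rebranching_skewed_tree:
  fixes \<pi> :: "nat \<Rightarrow> 'n::finite"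
  assumes "inj_on \<pi> {1..CARD('n)}"
  shows "no_rebranching {} (skewed_tree \<pi> k)"
proof -
  have "no_rebranching {} (skewed_stage \<pi> k i)" if "i \<le> CARD('n)" for i
    using that
  proof (induction i)
    case (Suc i)
    have "\<pi> (Suc i) \<notin> \<pi> ` {1..i}"
    proof
      assume "\<pi> (Suc i) \<in> \<pi> ` {1..i}"
      then obtain m where m: "m \<in> {1..i}" "\<pi> (Suc i) = \<pi> m"
        by auto
      then have "Suc i = m"
        using Suc.prems by (intro inj_onD[OF assms]) auto
      then show False
        using m by simp
    qed
    then have "\<pi> (Suc i) \<notin> set_bb_tree (skewed_stage \<pi> k i)"
      using set_skewed_stage[of \<pi> k i] by blast
    then show ?case
      using Suc by (simp add: no_rebranching_branch_leaves)
  qed simp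
  then show ?thesis
    by (simp add: skewed_tree_def)
qed


section \<open>The Sherali-Adams hierarchy\<close>

text \<open>A pair \<open>(a, b)\<close> encodes the inequality \<open>a \<bullet> x - b \<ge> 0\<close>.\<close>

definition polyhedron_of :: "((real ^ 'n::finite) \<times> real) set \<Rightarrow> (real ^ 'n) set" where
  "polyhedron_of S = {x. \<forall>(a, b)\<in>S. a \<bullet> x - b \<ge> 0}"

text \<open>The last two conjuncts say that the inequalities \<open>x\<^sub>i \<ge> 0\<close> and \<open>1 - x\<^sub>i \<ge> 0\<close> belong to the
  system.\<close>

definition describes :: "((real ^ 'n::finite) \<times> real) set \<Rightarrow> (real ^ 'n) set \<Rightarrow> bool" where
  "describes S P \<longleftrightarrow>
     finite S \<and> polyhedron_of S = P \<and>
     (\<forall>i. (axis i 1, 0) \<in> S) \<and> (\<forall>i. (- axis i 1, - 1) \<in> S)"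

text \<open>Expanding \<open>(a \<bullet> x - b) \<cdot> (\<Prod>i\<in>I. x\<^sub>i) \<cdot> (\<Prod>j\<in>J. (1 - x\<^sub>j))\<close> gives the sum over \<open>H \<subseteq> J\<close> of
  \<open>(-1)\<^bsup>card H\<^esup> \<cdot> ((\<Sum>l. a\<^sub>l \<cdot> x\<^sub>l) - b) \<cdot> (\<Prod>i\<in>I \<union> H. x\<^sub>i)\<close> for disjoint \<open>I\<close> and \<open>J\<close>.
  With \<open>x\<^sub>l\<^sup>2 = x\<^sub>l\<close>, the monomial \<open>x\<^sub>l \<cdot> (\<Prod>i\<in>I \<union> H. x\<^sub>i)\<close> becomes \<open>y (insert l (I \<union> H))\<close>.\<close>

definition lifted ::
    "real ^ 'n::finite \<Rightarrow> real \<Rightarrow> 'n set \<Rightarrow> 'n set \<Rightarrow> ('n set \<Rightarrow> real) \<Rightarrow> real" where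
  "lifted a b I J y =
     (\<Sum>H\<in>Pow J. (- 1) ^ card H *
        ((\<Sum>l\<in>UNIV. a $ l * y (insert l (I \<union> H))) - b * y (I \<union> H)))"

definition sherali_adams ::
    "nat \<Rightarrow> ((real ^ 'n::finite) \<times> real) set \<Rightarrow> (real ^ 'n) set" where
  "sherali_adams k S =
     {x. \<exists>y. y {} = 1 \<and> (\<forall>i. y {i} = x $ i) \<and>
          (\<forall>(a, b)\<in>S. \<forall>I J. I \<inter> J = {} \<longrightarrow> card I + card J \<le> k \<longrightarrow> lifted a b I J y \<ge> 0)}"

lemma lifted_zero_one:
  fixes x :: "real ^ 'n::finite"
  assumes "\<forall>i. x $ i \<in> {0, 1}" and "I \<inter> J = {}"
  shows "lifted a b I J (\<lambda>S. \<Prod>i\<in>S. x $ i) =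
           (a \<bullet> x - b) * (\<Prod>i\<in>I. x $ i) * (\<Prod>j\<in>J. (1 - x $ j))"
proof -
  have idem: "(\<Prod>i\<in>insert l S. x $ i) = x $ l * (\<Prod>i\<in>S. x $ i)" for l and S :: "'n set"
  proof (cases "l \<in> S")
    case True
    have "x $ l = x $ l * x $ l"
      using assms(1)[rule_format, of l] by auto
    moreover have "(\<Prod>i\<in>S. x $ i) = x $ l * (\<Prod>i\<in>S - {l}. x $ i)"
      using True by (simp add: prod.remove)
    ultimately show ?thesis
      using True by (simp add: insert_absorb mult.assoc[symmetric])
  qed simp
  have "lifted a b I J (\<lambda>S. \<Prod>i\<in>S. x $ i) =
      (\<Sum>H\<in>Pow J. (- 1) ^ card H * ((a \<bullet> x - b) * (\<Prod>i\<in>I \<union> H. x $ i)))"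
    unfolding lifted_def
    by (simp add: idem inner_vec_def left_diff_distrib sum_distrib_right mult.assoc)
  also have "\<dots> = (\<Sum>H\<in>Pow J. (a \<bullet> x - b) * (\<Prod>i\<in>I. x $ i) *
      ((- 1) ^ card H * (\<Prod>i\<in>H. x $ i)))"
  proof (rule sum.cong)
    fix H assume "H \<in> Pow J"
    then have "(\<Prod>i\<in>I \<union> H. x $ i) = (\<Prod>i\<in>I. x $ i) * (\<Prod>i\<in>H. x $ i)"
      using assms(2) by (intro prod.union_disjoint) auto
    then show "(- 1) ^ card H * ((a \<bullet> x - b) * (\<Prod>i\<in>I \<union> H. x $ i)) =
        (a \<bullet> x - b) * (\<Prod>i\<in>I. x $ i) * ((- 1) ^ card H * (\<Prod>i\<in>H. x $ i))"
      by simp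
  qed simp
  also have "\<dots> = (a \<bullet> x - b) * (\<Prod>i\<in>I. x $ i) * (\<Prod>j\<in>J. (1 - x $ j))"
    by (simp add: sum_distrib_left[symmetric] prod_diff_conv_sum)
  finally show ?thesis .
qed

lemma sherali_adams_0:
  fixes S :: "((real ^ 'n::finite) \<times> real) set"
  shows "sherali_adams 0 S = polyhedron_of S"
proof -
  have card0: "I = {} \<and> J = {}" if "card I + card J \<le> 0" for I J :: "'n set"
    using that by simp
  have "x \<in> polyhedron_of S" if "x \<in> sherali_adams 0 S" for x
  proof -
    from that obtain y where y: "y {} = 1" "\<forall>i. y {i} = x $ i"
      "\<forall>(a, b)\<in>S. \<forall>I J. I \<inter> J = {} \<longrightarrow> card I + card J \<le> 0 \<longrightarrow> lifted a b I J y \<ge> 0"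
      unfolding sherali_adams_def by blast
    have "lifted a b {} {} y \<ge> 0" if "(a, b) \<in> S" for a b
      using y(3) that by fastforce
    then show ?thesis
      using y(1,2) by (auto simp: polyhedron_of_def lifted_def inner_vec_def)
  qed
  moreover have "x \<in> sherali_adams 0 S" if "x \<in> polyhedron_of S" for x
    unfolding sherali_adams_def mem_Collect_eq
  proof (intro exI[of _ "\<lambda>S. \<Prod>i\<in>S. x $ i"] conjI ballI, goal_cases)
    case (3 c)
    then show ?case
      using that by (auto simp: polyhedron_of_def lifted_def inner_vec_def)
  qed auto
  ultimately show ?thesis
    by blast
qed

lemma describes_fractional_clique_polytope:
  fixes E :: "'n::finite set set"
  shows "describes
    ((\<lambda>i. (axis i 1, 0)) ` UNIV \<union> (\<lambda>i. (- axis i 1, - 1)) ` UNIV \<union>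
       (\<lambda>(u, v). (- axis u 1 - axis v 1, - 1)) ` {(u, v). u \<noteq> v \<and> {u, v} \<notin> E})
    (fractional_clique_polytope E)" (is "describes (?A \<union> ?B \<union> ?C) _")
proof -
  have "x \<in> polyhedron_of (?A \<union> ?B \<union> ?C) \<longleftrightarrow> x \<in> fractional_clique_polytope E"
    for x :: "real ^ 'n"
  proof -
    have "x \<in> polyhedron_of (?A \<union> ?B \<union> ?C) \<longleftrightarrow>
        (\<forall>i. 0 \<le> x $ i) \<and> (\<forall>i. x $ i \<le> 1) \<and>
        (\<forall>u v. u \<noteq> v \<and> {u, v} \<notin> E \<longrightarrow> - 1 \<le> - x $ u - x $ v)"
      unfolding polyhedron_of_def
      by (simp add: ball_Un inner_diff_left inner_axis' conj_assoc)
    moreover have "- 1 \<le> - x $ u - x $ v \<longleftrightarrow> x $ u + x $ v \<le> 1" for u v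
      by linarith
    ultimately show ?thesis
      by (auto simp: fractional_clique_polytope_def)
  qed
  then show ?thesis
    by (auto simp: describes_def)
qed

end

theory Submission
  imports Defs
begin

text \<open>
  \<^bold>\<open>Why the tree closes the gap.\<close> A leaf on whose path fewer than \<open>k\<close> variables were set to one
  has all variables fixed (\<open>leaves_skewed_stage\<close>), so its atom holds only
  integral points. At any other leaf let \<open>K\<close> be the set of variables set to one, with \<open>card K \<ge> k\<close>. If the atom is nonempty, then \<open>K\<close> is a clique, and no further vertex is
  adjacent to all of \<open>K\<close>, since that would give a clique larger than the maximum. So every vertex
  outside \<open>K\<close> shares an inequality \<open>x\<^sub>u + x\<^sub>v \<le> 1\<close> with some \<open>v \<in> K\<close>, which forces \<open>x\<^sub>u = 0\<close>; the
  atom is the single point \<open>1\<^sub>K\<close> (\<open>integral_if_ones_ge_clique_number\<close>). Conversely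
  branching never loses an integral point.

  \<^bold>\<open>Why Sherali-Adams does not.\<close> An integral point of the polytope is the incidence vector of a
  clique, and cliques have at most \<open>d + 1\<close> vertices, so \<open>\<Sum>\<^sub>i x\<^sub>i \<le> d + 1\<close> holds on the integer
  hull (\<open>sum_le_on_integer_hull\<close>). Level \<open>m\<close> of the hierarchy, however, contains the
  vector with all coordinates \<open>t = 1 / (m + 2)\<close>, whatever the graph and whatever system describes the polytope
  (\<open>constant_vector_in_sherali_adams\<close>); its coordinates sum to \<open>n / (m + 2)\<close>, which exceeds
  \<open>d + 1\<close> once \<open>m \<le> n / (d + 1) - 3\<close>.

  The lifting of the constant vector is the signed measure with mass \<open>t\<close> on every unit vector
  and the remaining mass \<open>1 - n t\<close>, negative if \<open>n > m + 2\<close>, on the origin. Multiplying by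
  \<open>\<Prod>\<^sub>i\<^sub>\<in>\<^sub>I x\<^sub>i \<Prod>\<^sub>j\<^sub>\<in>\<^sub>J (1 - x\<^sub>j)\<close> amounts to conditioning this measure on \<open>x\<^sub>I = 1\<close> and \<open>x\<^sub>J = 0\<close>.
  If \<open>I\<close> is nonempty, then at most one unit vector survives, and it lies in the polytope. If \<open>I\<close>
  is empty, then the total mass left is \<open>1 - card J t > 0\<close> and the barycentre has the coordinates
  \<open>t / (1 - card J t) \<le> 1 / 2\<close> outside \<open>J\<close> and \<open>0\<close> on \<open>J\<close>; it too lies in the polytope, because
  every vector with coordinates in \<open>[0, 1/2]\<close> does.
\<close>

section \<open>Integral points of branch-and-bound trees\<close>

lemma leaf_exists_for_integral_point:
  fixes x :: "real ^ 'n::finite"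
  assumes "\<forall>i. x $ i \<in> {0, 1}" and "\<forall>(j, b)\<in>C. x $ j = of_bool b"
  shows "\<exists>D\<in>leaves C T. \<forall>(j, b)\<in>D. x $ j = of_bool b"
  using assms(2)
proof (induction T arbitrary: C)
  case Leaf
  then show ?case
    unfolding leaves.simps by blast
next
  case (Branch j l r)
  have "x $ j = of_bool False \<or> x $ j = of_bool True"
    using assms(1)[rule_format, of j] by simp
  then show ?case
  proof
    assume "x $ j = of_bool False"
    then have "\<forall>(j, b)\<in>insert (j, False) C. x $ j = of_bool b"
      using Branch.prems by blast
    from Branch.IH(1)[OF this] show ?thesis
      unfolding leaves.simps by blast
  next
    assume "x $ j = of_bool True"
    then have "\<forall>(j, b)\<in>insert (j, True) C. x $ j = of_bool b"
      using Branch.prems by blast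
    from Branch.IH(2)[OF this] show ?thesis
      unfolding leaves.simps by blast
  qed
qed

lemma integer_hull_subset_bb_hull:
  fixes P :: "(real ^ 'n::finite) set"
  shows "integer_hull P \<subseteq> bb_hull T P"
  unfolding integer_hull_def bb_hull_def
proof (rule hull_mono, rule subsetI)
  fix x :: "real ^ 'n"
  assume x: "x \<in> P \<inter> {x. \<forall>i. x $ i \<in> {0, 1}}"
  have "\<exists>D\<in>leaves {} T. \<forall>(j, b)\<in>D. x $ j = of_bool b"
    using x by (intro leaf_exists_for_integral_point) blast+
  then show "x \<in> (\<Union>C\<in>leaves {} T. atom P C)"
    using x unfolding atom_def by blast
qed

lemma leaves_branch_leaves:
  assumes "D \<in> leaves C (branch_leaves k j C T)"
  shows "(D \<in> leaves C T \<and> k \<le> card (ones D)) \<or>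
    (\<exists>D'\<in>leaves C T. \<exists>b. D = insert (j, b) D')"
  using assms
proof (induction T arbitrary: C)
  case Leaf
  then show ?case
    by (auto split: if_splits)
next
  case (Branch i l r)
  from Branch.prems consider
      "D \<in> leaves (insert (i, False) C) (branch_leaves k j (insert (i, False) C) l)"
    | "D \<in> leaves (insert (i, True) C) (branch_leaves k j (insert (i, True) C) r)"
    by auto
  then show ?case
  proof cases
    case 1
    from Branch.IH(1)[OF this] show ?thesis
      by auto
  next
    case 2
    from Branch.IH(2)[OF this] show ?thesis
      by auto
  qed
qed

text \<open>A leaf is left alone only once it has \<open>k\<close> ones; until then every stage fixes one more
  variable at it.\<close>

lemma leaves_skewed_stage:
  fixes \<pi> :: "nat \<Rightarrow> 'n::finite"
  assumes "D \<in> leaves {} (skewed_stage \<pi> k i)"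
  shows "k \<le> card (ones D) \<or> \<pi> ` {1..i} \<subseteq> fst ` D"
  using assms
proof (induction i arbitrary: D)
  case (Suc i)
  have "D \<in> leaves {} (branch_leaves k (\<pi> (Suc i)) {} (skewed_stage \<pi> k i))"
    using Suc.prems by simp
  from leaves_branch_leaves[OF this] consider "k \<le> card (ones D)"
    | D' b where "D' \<in> leaves {} (skewed_stage \<pi> k i)" "D = insert (\<pi> (Suc i), b) D'"
    by blast
  then show ?case
  proof cases
    case (2 D' b)
    have "card (ones D') \<le> card (ones D)"
      using 2(2) by (intro card_mono) (auto simp: ones_def)
    moreover have "\<pi> ` {1..Suc i} \<subseteq> fst ` D" if "\<pi> ` {1..i} \<subseteq> fst ` D'"
    proof -
      have "\<pi> ` {1..Suc i} = insert (\<pi> (Suc i)) (\<pi> ` {1..i})"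
        by (simp add: atLeastAtMostSuc_conv)
      then show ?thesis
        using that unfolding 2(2) by auto
    qed
    ultimately show ?thesis
      using Suc.IH[OF 2(1)] by linarith
  qed simp
qed simp

section \<open>Cliques\<close>

lemma card_clique_le_clique_number:
  fixes V :: "'a set"
  assumes "finite V" and "clique V E C"
  shows "card C \<le> clique_number V E"
  unfolding clique_number_def
proof (rule Max_ge)
  have "{card C |C. clique V E C} = card ` {C. clique V E C}"
    by auto
  moreover have "finite {C. clique V E C}"
    using assms(1) by (auto intro: finite_subset[of _ "Pow V"] simp: clique_def)
  ultimately show "finite {card C |C. clique V E C}"
    by simp
qed (use assms(2) in auto)

text \<open>The least element exists because degrees are bounded by the number of vertex sets.\<close>

lemma degenerate_degeneracy:
  assumes "finite V"
  shows "degenerate (degeneracy V E) V E"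
  unfolding degeneracy_def
proof (rule LeastI)
  show "degenerate (card (Pow V)) V E"
    unfolding degenerate_def
  proof (intro allI impI)
    fix W F assume WF: "subgraph W F V E" "W \<noteq> {}"
    then obtain v where v: "v \<in> W"
      by blast
    have W: "finite W"
      using WF by (auto simp: subgraph_def simple_graph_def)
    have "min_degree W F \<le> degree F v"
      unfolding min_degree_def using W v by (intro Min_le) auto
    also have "\<dots> \<le> card (Pow V)"
      unfolding degree_def using WF assms
      by (intro card_mono) (auto simp: subgraph_def simple_graph_def)
    finally show "min_degree W F \<le> card (Pow V)" .
  qed
qed

text \<open>A clique, taken with all its edges, is a subgraph in which every degree is one less than
  its number of vertices.\<close>

lemma card_clique_le_degeneracy:
  assumes "finite V" and "clique V E C"
  shows "card C \<le> degeneracy V E + 1"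
proof (cases "C = {}")
  case False
  define F where "F = {e. e \<subseteq> C \<and> card e = 2}"
  have C: "finite C" "C \<subseteq> V"
    using assms finite_subset by (auto simp: clique_def)
  have "F \<subseteq> E"
    using assms(2) by (auto simp: F_def clique_def card_2_iff)
  then have "subgraph C F V E"
    using C by (auto simp: subgraph_def simple_graph_def F_def)
  then have min: "min_degree C F \<le> degeneracy V E"
    using degenerate_degeneracy[OF assms(1), of E] False by (auto simp: degenerate_def)
  have "degree F v = card C - 1" if v: "v \<in> C" for v
  proof -
    have "{e \<in> F. v \<in> e} = (\<lambda>u. {u, v}) ` (C - {v})"
      using v by (auto simp: F_def card_2_iff)
    moreover have "inj_on (\<lambda>u. {u, v}) (C - {v})"
      by (auto simp: inj_on_def doubleton_eq_iff)
    ultimately show ?thesis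
      using v C by (simp add: degree_def card_image)
  qed
  then have "degree F ` C = {card C - 1}"
    using False by auto
  then show ?thesis
    using min by (simp add: min_degree_def)
qed simp

section \<open>The skewed tree describes the integer hull\<close>

lemma clique_of_ones:
  assumes "x \<in> fractional_clique_polytope E" and "\<forall>i\<in>K. x $ i = 1"
  shows "clique UNIV E K"
  unfolding clique_def
proof (intro conjI ballI impI)
  fix u v assume uv: "u \<in> K" "v \<in> K" "u \<noteq> v"
  show "{u, v} \<in> E"
  proof (rule ccontr)
    assume "{u, v} \<notin> E"
    then have "x $ u + x $ v \<le> 1"
      using assms(1) uv by (auto simp: fractional_clique_polytope_def)
    then show False
      using assms(2) uv by simp
  qed
qed simp

text \<open>The ones form a maximum clique, so every other vertex has a non-neighbour among them, whose
  inequality forces its coordinate to zero.\<close>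

lemma integral_if_ones_ge_clique_number:
  fixes E :: "'n::finite set set"
  assumes x: "x \<in> fractional_clique_polytope E" and ones: "\<forall>i\<in>K. x $ i = 1"
    and card: "clique_number UNIV E \<le> card K"
  shows "x $ u \<in> {0, 1}"
proof (cases "u \<in> K")
  case False
  have K: "clique UNIV E K"
    using clique_of_ones[OF x ones] .
  have "\<exists>v\<in>K. {u, v} \<notin> E"
  proof (rule ccontr)
    assume "\<not> (\<exists>v\<in>K. {u, v} \<notin> E)"
    then have "clique UNIV E (insert u K)"
      using K by (auto simp: clique_def insert_commute)
    from card_clique_le_clique_number[OF _ this] show False
      using False card by simp
  qed
  then obtain v where v: "v \<in> K" "{u, v} \<notin> E"
    by blast
  moreover have "u \<noteq> v"
    using v(1) False by blast
  ultimately have "x $ u + x $ v \<le> 1" "0 \<le> x $ u"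
    using x by (auto simp: fractional_clique_polytope_def)
  then show ?thesis
    using ones v(1) by simp
qed (use ones in simp)

lemma bb_hull_skewed_tree:
  fixes E :: "'n::finite set set"
  assumes "\<pi> ` {1..CARD('n)} = UNIV"
  shows "bb_hull (skewed_tree \<pi> (clique_number UNIV E)) (fractional_clique_polytope E) =
    integer_hull (fractional_clique_polytope E)" (is "bb_hull ?T ?P = _")
proof (rule antisym)
  show "bb_hull ?T ?P \<subseteq> integer_hull ?P"
    unfolding integer_hull_def bb_hull_def
  proof (rule hull_mono, rule subsetI)
    fix x assume "x \<in> (\<Union>C\<in>leaves {} ?T. atom ?P C)"
    then obtain C where C: "C \<in> leaves {} ?T" and x: "x \<in> ?P"
      and xC: "\<forall>(j, b)\<in>C. x $ j = of_bool b"
      by (auto simp: atom_def)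
    have "x $ u \<in> {0, 1}" for u
    proof -
      consider "clique_number UNIV E \<le> card (ones C)" | "u \<in> fst ` C"
        using leaves_skewed_stage[of C \<pi> "clique_number UNIV E" "CARD('n)"] C assms
        unfolding skewed_tree_def by blast
      then show ?thesis
      proof cases
        case 1
        have "\<forall>i\<in>ones C. x $ i = 1"
          using xC by (auto simp: ones_def)
        from integral_if_ones_ge_clique_number[OF x this 1] show ?thesis .
      next
        case 2
        then obtain b where "(u, b) \<in> C"
          by auto
        with xC have "x $ u = of_bool b"
          by blast
        then show ?thesis
          by (cases b) auto
      qed
    qed
    then show "x \<in> ?P \<inter> {x. \<forall>i. x $ i \<in> {0, 1}}"
      using x by simp
  qed
qed (rule integer_hull_subset_bb_hull)

section \<open>The constant vector survives many Sherali-Adams levels\<close>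

lemma lifted_add: "lifted a b I J (\<lambda>S. f S + g S) = lifted a b I J f + lifted a b I J g"
  unfolding lifted_def
  by (simp only: sum.distrib[symmetric]) (intro sum.cong refl, simp add: sum.distrib algebra_simps)

lemma lifted_cmult: "lifted a b I J (\<lambda>S. c * f S) = c * lifted a b I J f"
  unfolding lifted_def
  by (simp add: sum_distrib_left algebra_simps)

lemma lifted_sum:
  "finite A \<Longrightarrow> lifted a b I J (\<lambda>S. \<Sum>l\<in>A. f l S) = (\<Sum>l\<in>A. lifted a b I J (f l))"
proof (induction A rule: finite_induct)
  case empty
  show ?case
    by (simp add: lifted_def)
qed (simp add: lifted_add)

text \<open>The moments of the signed measure with mass \<open>t\<close> on each unit vector and mass
  \<open>1 - n t\<close> on the origin.\<close>

definition unit_vector_moments :: "real \<Rightarrow> 'n::finite set \<Rightarrow> real" where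
  "unit_vector_moments t S =
     (1 - real CARD('n) * t) * (\<Prod>i\<in>S. (0 :: real ^ 'n) $ i) +
     (\<Sum>l\<in>UNIV. t * (\<Prod>i\<in>S. (axis l 1 :: real ^ 'n) $ i))"

lemma unit_vector_moments_empty: "unit_vector_moments t ({} :: 'n::finite set) = 1"
  by (simp add: unit_vector_moments_def)

lemma unit_vector_moments_singleton: "unit_vector_moments t {i :: 'n::finite} = t"
  by (simp add: unit_vector_moments_def axis_def if_distrib[of "(*) t"] cong: if_cong)

text \<open>Linearity reduces this to the point masses, where the lifted inequality is the original
  product.\<close>

lemma lifted_unit_vector_moments:
  fixes a :: "real ^ 'n::finite"
  assumes "I \<inter> J = {}"
  shows "lifted a b I J (unit_vector_moments t) =
    (1 - real CARD('n) * t) * (- b * of_bool (I = {})) +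
    (\<Sum>l\<in>UNIV. t * ((a $ l - b) * of_bool (I \<subseteq> {l}) * of_bool (l \<notin> J)))"
proof -
  have zero: "lifted a b I J (\<lambda>S. \<Prod>i\<in>S. (0 :: real ^ 'n) $ i) = - b * of_bool (I = {})"
    by (subst lifted_zero_one) (use assms in \<open>auto simp: prod_zero_iff\<close>)
  have "(\<Prod>i\<in>I. (axis l 1 :: real ^ 'n) $ i) = of_bool (I \<subseteq> {l})" for l
    by (auto simp: axis_def intro!: prod.neutral split: if_splits)
  moreover have "(\<Prod>j\<in>J. (1 - (axis l 1 :: real ^ 'n) $ j)) = of_bool (l \<notin> J)" for l
    by (auto simp: axis_def intro!: prod.neutral)
  moreover have "\<forall>i. (axis l 1 :: real ^ 'n) $ i \<in> {0, 1}" for l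
    by (simp add: axis_def)
  ultimately have unit: "lifted a b I J (\<lambda>S. \<Prod>i\<in>S. (axis l 1 :: real ^ 'n) $ i) =
      (a $ l - b) * of_bool (I \<subseteq> {l}) * of_bool (l \<notin> J)" for l
    by (subst lifted_zero_one) (use assms in \<open>simp_all add: inner_axis\<close>)
  show ?thesis
    unfolding unit_vector_moments_def
    by (simp only: lifted_add lifted_cmult lifted_sum finite zero unit)
qed

text \<open>The two assumptions cover the points at which the original inequalities are evaluated:
  conditioning the signed measure on a one leaves a unit vector or nothing, and conditioning on
  at most \<open>m\<close> zeros leaves a barycentre with coordinates at most \<open>1/2\<close>. The value of \<open>t\<close> is the
  largest one with \<open>t / (1 - m t) \<le> 1/2\<close>.\<close>

lemma constant_vector_in_sherali_adams:
  fixes S :: "((real ^ 'n::finite) \<times> real) set"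
  assumes half: "\<And>x :: real ^ 'n. (\<forall>i. 0 \<le> x $ i \<and> x $ i \<le> 1 / 2) \<Longrightarrow> x \<in> polyhedron_of S"
    and unit: "\<And>l. axis l 1 \<in> polyhedron_of S"
  shows "(\<chi> i. 1 / (real m + 2)) \<in> sherali_adams m S"
proof -
  define t where "t = 1 / (real m + 2)"
  have t: "t > 0"
    by (simp add: t_def)
  have "lifted a b I J (unit_vector_moments t) \<ge> 0"
    if S: "(a, b) \<in> S" and IJ: "I \<inter> J = {}" "card I + card J \<le> m" for a b I J
  proof (cases "I = {}")
    case False
    have "a $ l - b \<ge> 0" for l
      using unit[of l] S by (auto simp: polyhedron_of_def inner_axis)
    then show ?thesis
      using False t unfolding lifted_unit_vector_moments[OF IJ(1)]
      by (auto intro!: sum_nonneg)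
  next
    case True
    \<comment> \<open>The mass that remains after discarding the unit vectors of \<open>J\<close>; it normalises the
      barycentre \<open>x\<close> below.\<close>
    define s where "s = 1 - real (card J) * t"
    have "2 * t = 1 - real m * t"
      by (simp add: t_def field_simps)
    also have "\<dots> \<le> s"
      using IJ(2) t unfolding s_def by (simp add: mult_right_mono)
    finally have s: "2 * t \<le> s" .
    define x :: "real ^ 'n" where "x = (\<chi> l. t / s * of_bool (l \<notin> J))"
    have "x \<in> polyhedron_of S"
      using s t by (intro half) (auto simp: x_def field_simps)
    then have "0 \<le> s * (a \<bullet> x - b)"
      using S s t by (auto simp: polyhedron_of_def)
    also have "\<dots> = (\<Sum>l\<in>UNIV. t * (a $ l * of_bool (l \<notin> J))) - s * b"
      using s t by (simp add: x_def inner_vec_def right_diff_distrib sum_distrib_left mult_ac)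
    also have "\<dots> = lifted a b I J (unit_vector_moments t)"
    proof -
      have "(\<Sum>l\<in>UNIV. of_bool (l \<notin> J)) = real CARD('n) - real (card J)"
        by (simp add: sum_subtractf of_bool_not_iff del: sum_of_bool_eq)
          simp
      then have "(\<Sum>l\<in>UNIV. t * (b * of_bool (l \<notin> J))) =
          t * b * (real CARD('n) - real (card J))"
        by (simp add: sum_distrib_left[symmetric] mult.assoc)
      then show ?thesis
        unfolding lifted_unit_vector_moments[OF IJ(1)] using True
        by (simp add: s_def left_diff_distrib right_diff_distrib sum_subtractf mult_ac)
    qed
    finally show ?thesis .
  qed
  then show ?thesis
    unfolding sherali_adams_def t_def[symmetric]
    by (auto intro!: exI[of _ "unit_vector_moments t"]
        simp: unit_vector_moments_empty unit_vector_moments_singleton)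
qed

lemma sum_le_on_integer_hull:
  fixes E :: "'n::finite set set"
  assumes "x \<in> integer_hull (fractional_clique_polytope E)"
  shows "(\<Sum>i\<in>UNIV. x $ i) \<le> real (degeneracy UNIV E) + 1"
proof -
  let ?H = "{x :: real ^ 'n. (\<Sum>i\<in>UNIV. x $ i) \<le> real (degeneracy UNIV E) + 1}"
  have "?H = {x. (\<chi> i. 1) \<bullet> x \<le> real (degeneracy UNIV E) + 1}"
    by (simp add: inner_vec_def)
  then have "convex ?H"
    by (simp add: convex_halfspace_le)
  moreover have "y \<in> ?H"
    if y: "y \<in> fractional_clique_polytope E" "\<forall>i. y $ i \<in> {0, 1}" for y
  proof -
    define K where "K = {i. y $ i = 1}"
    have "clique UNIV E K"
      using y by (intro clique_of_ones) (auto simp: K_def)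
    then have "card K \<le> degeneracy UNIV E + 1"
      by (intro card_clique_le_degeneracy) auto
    moreover have "(\<Sum>i\<in>UNIV. y $ i) = (\<Sum>i\<in>UNIV. if i \<in> K then 1 else 0)"
      using y(2) by (intro sum.cong) (auto simp: K_def)
    ultimately show ?thesis
      by (simp add: sum.If_cases)
  qed
  ultimately have "integer_hull (fractional_clique_polytope E) \<subseteq> ?H"
    unfolding integer_hull_def by (intro hull_minimal) auto
  then show ?thesis
    using assms by auto
qed

theorem theorem5:
  fixes E :: "'n::finite set set" and \<pi> :: "nat \<Rightarrow> 'n" and n k d :: nat
  assumes "simple_graph UNIV E"
    and "n = CARD('n)"
    and "k = clique_number UNIV E"
    and "d = degeneracy UNIV E"
    and "bij_betw \<pi> {1..n} UNIV"
  shows "bb_hull (skewed_tree \<pi> k) (fractional_clique_polytope E) =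
           integer_hull (fractional_clique_polytope E) \<and>
         (\<lfloor>real n / (real d + 1) - 3\<rfloor> \<ge> 0 \<longrightarrow>
           (\<forall>S. describes S (fractional_clique_polytope E) \<longrightarrow>
             sherali_adams (nat \<lfloor>real n / (real d + 1) - 3\<rfloor>) S
               \<noteq> integer_hull (fractional_clique_polytope E)))"
proof (intro conjI impI allI)
  show "bb_hull (skewed_tree \<pi> k) (fractional_clique_polytope E) =
      integer_hull (fractional_clique_polytope E)"
    unfolding assms(3)
    by (rule bb_hull_skewed_tree) (use assms(2,5) in \<open>simp add: bij_betw_def\<close>)
next
  fix S
  assume nonneg: "\<lfloor>real n / (real d + 1) - 3\<rfloor> \<ge> 0"
    and S: "describes S (fractional_clique_polytope E)"
  define m where "m = nat \<lfloor>real n / (real d + 1) - 3\<rfloor>"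
  let ?x = "(\<chi> i. 1 / (real m + 2)) :: real ^ 'n"
  have P: "polyhedron_of S = fractional_clique_polytope E"
    using S by (simp add: describes_def)
  have "?x \<in> sherali_adams m S"
  proof (rule constant_vector_in_sherali_adams)
    fix x :: "real ^ 'n" assume x: "\<forall>i. 0 \<le> x $ i \<and> x $ i \<le> 1 / 2"
    have "x $ i \<le> 1" "x $ i + x $ j \<le> 1" for i j
      using x[rule_format, of i] x[rule_format, of j] by linarith+
    then show "x \<in> polyhedron_of S"
      using x by (simp add: P fractional_clique_polytope_def)
  next
    show "axis l 1 \<in> polyhedron_of S" for l
      by (simp add: P fractional_clique_polytope_def axis_def)
  qed
  moreover have "?x \<notin> integer_hull (fractional_clique_polytope E)"
  proof
    assume "?x \<in> integer_hull (fractional_clique_polytope E)"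
    then have "real n / (real m + 2) \<le> real d + 1"
      using sum_le_on_integer_hull[of ?x E] assms(2,4) by simp
    moreover have "real m \<le> real n / (real d + 1) - 3"
      using nonneg of_int_floor_le[of "real n / (real d + 1) - 3"]
      unfolding m_def by (simp add: of_nat_nat)
    then have "(real m + 2) * (real d + 1) < real n"
      by (simp add: field_simps)
    ultimately show False
      by (simp add: field_simps)
  qed
  ultimately show "sherali_adams (nat \<lfloor>real n / (real d + 1) - 3\<rfloor>) S
      \<noteq> integer_hull (fractional_clique_polytope E)"
    unfolding m_def by blast
qed

end
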